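(* Let $\mathcal{A}$ be a Boolean tensor of size $I_1\times\cdots\times I_M\times J_1\times\cdots\times J_N$ and $\mathcal{X}$ a Boolean tensor of size $J_1\times\cdots\times J_N\times I_1\times\cdots\times I_M$. Then $$\mathcal{A}*_N\mathcal{X}*_M\mathcal{A}\leq\mathcal{A}\quad\text{if and only if}\quad\mathcal{X}\leq\left(\mathcal{A}*_N\mathcal{A}^{CT}*_M\mathcal{A}\right)^{CT}.$$
   Context: A Boolean tensor is an array with entries in $\{0,1\}$; entries are added and multiplied by the rules of the binary Boolean algebra ($1+1=1$, otherwise as usual). For $\mathcal{A}$ of size $I_1\times\cdots\times I_M\times J_1\times\cdots\times J_N$ and $\mathcal{B}$ of size $J_1\times\cdots\times J_N\times K_1\times\cdots\times K_L$, the Einstein product $\mathcal{A}*_N\mathcal{B}$ has entries $\sum_{j_1,\dots,j_N}a_{i_1\ldots i_Mj_1\ldots j_N}b_{j_1\ldots j_Nk_1\ldots k_L}$ (Boolean sum); the subscript of $*$ is the number of contracted indices. The transpose is $(\mathcal{A}^T)_{j_1\ldots j_Ni_1\ldots i_M}=a_{i_1\ldots i_Mj_1\ldots j_N}$. The component-wise complement $\mathcal{A}^C$ has the same size as $\mathcal{A}$ and is obtained by exchanging the entries $0$ and $1$; $\mathcal{A}^{CT}=(\mathcal{A}^C)^T=(\mathcal{A}^T)^C$. $\mathcal{A}\le\mathcal{B}$ means entrywise inequality. *)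

theory Defs
  imports Main
begin

text \<open>
  Entries are taken from the two-element Boolean algebra \<open>bool\<close>: \<open>0\<close> is \<open>False\<close>, \<open>1\<close> is
  \<open>True\<close>, Boolean addition is the join and multiplication the meet.  The order of a tensor is
  arbitrary, so a size \<open>I\<^sub>1 \<times> \<dots> \<times> I\<^sub>M\<close> is the list \<open>[I\<^sub>1, \<dots>, I\<^sub>M]\<close> and a multi-index is a list of
  the same length; indices run from \<open>0\<close> to \<open>I\<^sub>k - 1\<close>.
\<close>

definition indices :: "nat list \<Rightarrow> nat list set" where
  "indices d = {i. list_all2 (<) i d}"

text \<open>
  Entries at positions outside the size are fixed to \<open>False\<close>, so that two tensors are equal
  exactly when they have the same size and the same entries.
\<close>

typedef btensor = "{(d :: nat list, a :: nat list \<Rightarrow> bool). \<forall>i. a i \<longrightarrow> i \<in> indices d}"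
  by (rule exI[of _ "([], \<lambda>_. False)"]) simp

setup_lifting type_definition_btensor

lift_definition shape :: "btensor \<Rightarrow> nat list" is fst .

lift_definition entry :: "btensor \<Rightarrow> nat list \<Rightarrow> bool" is snd .

lift_definition mk_btensor :: "nat list \<Rightarrow> (nat list \<Rightarrow> bool) \<Rightarrow> btensor"
  is "\<lambda>d a. (d, \<lambda>i. i \<in> indices d \<and> a i)"
  by auto

lemma shape_mk_btensor [simp]: "shape (mk_btensor d a) = d"
  by transfer simp

lemma entry_mk_btensor [simp]: "entry (mk_btensor d a) i \<longleftrightarrow> i \<in> indices d \<and> a i"
  by transfer simp

lemma entry_imp_indices: "entry A i \<Longrightarrow> i \<in> indices (shape A)"
  by transfer auto

lemma btensor_eqI:
  assumes "shape A = shape B" and "\<And>i. i \<in> indices (shape A) \<Longrightarrow> entry A i = entry B i"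
  shows "A = B"
proof -
  have "entry A = entry B"
    using assms entry_imp_indices[of A] entry_imp_indices[of B] by fastforce
  with assms(1) show ?thesis
    by transfer (auto simp: prod_eq_iff)
qed

instantiation btensor :: order
begin

definition less_eq_btensor :: "btensor \<Rightarrow> btensor \<Rightarrow> bool" where
  "A \<le> B \<longleftrightarrow> shape A = shape B \<and> (\<forall>i\<in>indices (shape A). entry A i \<le> entry B i)"

definition less_btensor :: "btensor \<Rightarrow> btensor \<Rightarrow> bool" where
  "A < B \<longleftrightarrow> A \<le> B \<and> \<not> B \<le> (A :: btensor)"

instance
proof
  fix A B C :: btensor
  show "A < B \<longleftrightarrow> A \<le> B \<and> \<not> B \<le> A"
    by (rule less_btensor_def)
  show "A \<le> A"
    by (simp add: less_eq_btensor_def)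
  show "A \<le> C" if "A \<le> B" "B \<le> C"
    using that by (auto simp: less_eq_btensor_def)
  show "A = B" if "A \<le> B" "B \<le> A"
    using that by (intro btensor_eqI) (auto simp: less_eq_btensor_def)
qed

end

text \<open>
  \<open>A \<star>\<^bsub>N\<^esub> B\<close> contracts the last \<open>N\<close> indices of \<open>A\<close> with the first \<open>N\<close> indices of \<open>B\<close>.  It is
  meaningful only if the corresponding sizes agree; the size of the contracted part is read off
  from \<open>A\<close>.
\<close>

definition einstein_prod :: "btensor \<Rightarrow> nat \<Rightarrow> btensor \<Rightarrow> btensor"
    (\<open>(_ \<star>\<^bsub>_\<^esub> _)\<close> [70, 0, 71] 70) where
  "A \<star>\<^bsub>N\<^esub> B =
    (let m = length (shape A) - N in
      mk_btensor (take m (shape A) @ drop N (shape B))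
        (\<lambda>l. SUP j \<in> indices (drop m (shape A)).
           inf (entry A (take m l @ j)) (entry B (j @ drop m l))))"

text \<open>
  The transpose depends on how the indices are divided into two groups: \<open>M\<close> is the number of
  indices in the first group, so that an index \<open>l\<close> of the transpose has the form \<open>j @ i\<close> with
  \<open>length i = M\<close>.
\<close>

definition transpose_bt :: "nat \<Rightarrow> btensor \<Rightarrow> btensor" where
  "transpose_bt M A =
    (let n = length (shape A) - M in
      mk_btensor (drop M (shape A) @ take M (shape A))
        (\<lambda>l. entry A (drop n l @ take n l)))"

definition compl_bt :: "btensor \<Rightarrow> btensor" where
  "compl_bt A = mk_btensor (shape A) (\<lambda>i. \<not> entry A i)"

definition compl_transpose :: "nat \<Rightarrow> btensor \<Rightarrow> btensor" where
  "compl_transpose M A = transpose_bt M (compl_bt A)"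

lemma indices_append:
  "indices (d @ e) = {i @ j | i j. i \<in> indices d \<and> j \<in> indices e}"
  by (auto simp: indices_def list_all2_append2 list_all2_appendI dest: list_all2_lengthD)

lemma compl_transpose_alt:
  "compl_transpose M A = compl_bt (transpose_bt M A)"
proof (rule btensor_eqI)
  let ?n = "length (shape A) - M"
  fix l assume "l \<in> indices (shape (compl_transpose M A))"
  then have l: "l \<in> indices (drop M (shape A) @ take M (shape A))"
    by (simp add: compl_transpose_def transpose_bt_def compl_bt_def Let_def)
  then obtain j i where ji: "l = j @ i" "j \<in> indices (drop M (shape A))"
      "i \<in> indices (take M (shape A))"
    by (auto simp: indices_append)
  then have "length j = ?n"
    by (auto simp: indices_def dest: list_all2_lengthD)
  moreover have "i @ j \<in> indices (shape A)"
    using ji indices_append[of "take M (shape A)" "drop M (shape A)"] by auto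
  ultimately show "entry (compl_transpose M A) l = entry (compl_bt (transpose_bt M A)) l"
    using l ji by (simp add: compl_transpose_def transpose_bt_def compl_bt_def Let_def)
qed (simp add: compl_transpose_def transpose_bt_def compl_bt_def Let_def)

end

theory Submission
  imports Defs
begin

text \<open>
  Both inequalities unfold to one and the same first-order condition.  Split every multi-index at
  the boundary of the blocks \<open>I\<close> and \<open>J\<close>.  Then \<open>A X A \<le> A\<close> says that no
  \<open>i, i' \<in> indices I\<close>, \<open>j, j' \<in> indices J\<close> satisfy

    \<open>entry A (i @ j') \<and> entry X (j' @ i') \<and> entry A (i' @ j) \<and> \<not> entry A (i @ j)\<close>.

  Read \<open>\<not> entry A (i @ j)\<close> as the \<open>(j @ i)\<close>-entry of the complemented transpose \<open>Y\<close> of \<open>A\<close>.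
  Reordering the factors as \<open>entry A (i' @ j) \<and> entry Y (j @ i) \<and> entry A (i @ j')\<close> shows that
  the condition forbids \<open>entry X (j' @ i')\<close> exactly when \<open>A Y A\<close> has entry \<open>1\<close> at \<open>i' @ j'\<close>,
  and this is the second inequality.  Hence it suffices to describe the order, the product and the
  complemented transpose by entries at split indices.
\<close>

lemma length_indices: "i \<in> indices d \<Longrightarrow> length i = length d"
  by (auto simp: indices_def dest: list_all2_lengthD)

lemma append_in_indices_append:
  "i \<in> indices d \<Longrightarrow> j \<in> indices e \<Longrightarrow> i @ j \<in> indices (d @ e)"
  by (auto simp: indices_append)

lemma less_eq_btensor_append_iff:
  assumes "shape A = I @ J" "shape B = I @ J"
  shows "A \<le> B \<longleftrightarrow>
    (\<forall>i\<in>indices I. \<forall>j\<in>indices J. entry A (i @ j) \<longrightarrow> entry B (i @ j))"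
  using assms by (auto simp: less_eq_btensor_def indices_append)

lemma shape_einstein_prod:
  assumes "shape A = I @ J" "shape B = J @ K" "length J = N"
  shows "shape (A \<star>\<^bsub>N\<^esub> B) = I @ K"
  using assms by (simp add: einstein_prod_def Let_def)

lemma entry_einstein_prod_append:
  assumes "shape A = I @ J" "shape B = J @ K" "length J = N"
    and "i \<in> indices I" "k \<in> indices K"
  shows "entry (A \<star>\<^bsub>N\<^esub> B) (i @ k) \<longleftrightarrow>
    (\<exists>j\<in>indices J. entry A (i @ j) \<and> entry B (j @ k))"
  using assms length_indices[OF assms(4)]
  by (simp add: einstein_prod_def Let_def append_in_indices_append)

lemma shape_compl_transpose:
  assumes "shape A = I @ J" "length I = M"
  shows "shape (compl_transpose M A) = J @ I"
  using assms by (simp add: compl_transpose_def transpose_bt_def compl_bt_def Let_def)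

lemma entry_compl_transpose_append:
  assumes "shape A = I @ J" "length I = M"
    and "i \<in> indices I" "j \<in> indices J"
  shows "entry (compl_transpose M A) (j @ i) \<longleftrightarrow> \<not> entry A (i @ j)"
  using assms length_indices[OF assms(4)]
  by (simp add: compl_transpose_def transpose_bt_def compl_bt_def Let_def
      append_in_indices_append)

lemma entry_triple_prod_append:
  assumes "shape A = I @ J" "shape B = J @ K" "shape C = K @ L"
    and "length J = N" "length K = M"
    and "i \<in> indices I" "l \<in> indices L"
  shows "entry (A \<star>\<^bsub>N\<^esub> B \<star>\<^bsub>M\<^esub> C) (i @ l) \<longleftrightarrow>
    (\<exists>j\<in>indices J. \<exists>k\<in>indices K.
      entry A (i @ j) \<and> entry B (j @ k) \<and> entry C (k @ l))"
proof -
  have AB: "shape (A \<star>\<^bsub>N\<^esub> B) = I @ K"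
    using assms by (intro shape_einstein_prod)
  have "entry (A \<star>\<^bsub>N\<^esub> B \<star>\<^bsub>M\<^esub> C) (i @ l) \<longleftrightarrow>
      (\<exists>k\<in>indices K. entry (A \<star>\<^bsub>N\<^esub> B) (i @ k) \<and> entry C (k @ l))"
    using assms by (intro entry_einstein_prod_append[OF AB])
  also have "\<dots> \<longleftrightarrow>
      (\<exists>k\<in>indices K. (\<exists>j\<in>indices J. entry A (i @ j) \<and> entry B (j @ k)) \<and> entry C (k @ l))"
    using assms by (simp add: entry_einstein_prod_append cong: bex_cong)
  finally show ?thesis
    by blast
qed

theorem theorem3p22:
  fixes A X :: btensor and I J :: "nat list" and M N :: nat
  assumes "length I = M" and "length J = N"
    and "shape A = I @ J" and "shape X = J @ I"
  shows "A \<star>\<^bsub>N\<^esub> X \<star>\<^bsub>M\<^esub> A \<le> A \<longleftrightarrow>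
    X \<le> compl_transpose M (A \<star>\<^bsub>N\<^esub> compl_transpose M A \<star>\<^bsub>M\<^esub> A)"
proof -
  let ?Y = "compl_transpose M A"
  have Y: "shape ?Y = J @ I"
    by (rule shape_compl_transpose[OF assms(3,1)])
  have shape: "shape (A \<star>\<^bsub>N\<^esub> Z \<star>\<^bsub>M\<^esub> A) = I @ J" if "shape Z = J @ I" for Z
    by (rule shape_einstein_prod[OF shape_einstein_prod[OF assms(3) that assms(2)] assms(3,1)])
  note entry = entry_triple_prod_append[OF assms(3) _ assms(3,2,1)]
  have "A \<star>\<^bsub>N\<^esub> X \<star>\<^bsub>M\<^esub> A \<le> A \<longleftrightarrow>
      (\<forall>i\<in>indices I. \<forall>j\<in>indices J. \<forall>j'\<in>indices J. \<forall>i'\<in>indices I.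
        entry A (i @ j') \<and> entry X (j' @ i') \<and> entry A (i' @ j) \<longrightarrow> entry A (i @ j))"
    by (simp add: less_eq_btensor_append_iff[OF shape[OF assms(4)] assms(3)]
        entry[OF assms(4)])
  also have "\<dots> \<longleftrightarrow>
      (\<forall>j'\<in>indices J. \<forall>i'\<in>indices I. entry X (j' @ i') \<longrightarrow>
        \<not> (\<exists>j\<in>indices J. \<exists>i\<in>indices I.
            entry A (i' @ j) \<and> entry ?Y (j @ i) \<and> entry A (i @ j')))"
    by (simp add: entry_compl_transpose_append[OF assms(3,1)] cong: bex_cong) blast
  also have "\<dots> \<longleftrightarrow> X \<le> compl_transpose M (A \<star>\<^bsub>N\<^esub> ?Y \<star>\<^bsub>M\<^esub> A)"
    by (simp add: less_eq_btensor_append_iff[OF assms(4)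
          shape_compl_transpose[OF shape[OF Y] assms(1)]]
        entry_compl_transpose_append[OF shape[OF Y] assms(1)] entry[OF Y])
  finally show ?thesis .
qed

end
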